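(* Let $\mathcal{H}$ be a real or complex Hilbert space with $\dim\mathcal{H}=n\in\mathbb{N}$, let $\mathcal{F}=\{f_i\}_{i=1}^p\subseteq\mathcal{H}$ be a finite sequence with frame operator $S^{\mathcal{F}}$, let $\lambda_1\ge\dots\ge\lambda_n$ be the eigenvalues of $S^{\mathcal{F}}$ counted with multiplicity, let $\alpha=\operatorname{tr}(S^{\mathcal{F}})$, and let $\{a_i\}_{i\in\mathbb{N}}$ be a non-increasing sequence of positive real numbers. (i) Given $r\in\mathbb{N}$, there exists a finite sequence $\mathcal{G}=\{g_i\}_{i=1}^r\subseteq\mathcal{H}$ with $\|g_i\|^2=a_i$ for $1\le i\le r$ such that $\mathcal{F}\cup\mathcal{G}$ is a tight frame for $\mathcal{H}$ if and only if $\frac1n\left(\sum_{i=1}^r a_i+\alpha\right)\ge\lambda_1$ and $$\frac1n\left(\sum_{i=1}^r a_i+\alpha\right)\ \ge\ \frac1k\sum_{i=1}^k (a_i+\lambda_{n-i+1}),\qquad 1\le k\le\min\{n,r\}.$$ (ii) There exists an infinite Bessel sequence $\mathcal{G}=\{g_i\}_{i=1}^\infty$ in $\mathcal{H}$ with $\|g_i\|^2=a_i$ for all $i\ge 1$ such that $\mathcal{F}\cup\mathcal{G}$ is a tight frame for $\mathcal{H}$ if and only if $\{a_i\}_{i=1}^\infty\in\ell^1(\mathbb{N})$, $\frac1n\left(\sum_{i=1}^\infty a_i+\alpha\right)\ge\lambda_1$ and $$\frac1n\left(\sum_{i=1}^\infty a_i+\alpha\right)\ \ge\ \frac1k\sum_{i=1}^k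 (a_i+\lambda_{n-i+1}),\qquad 1\le k\le n.$$
   Context: $\mathbb{N}=\{1,2,\dots\}$. For $m\in\mathbb{N}\cup\{\infty\}$, a sequence $\{f_i\}_{i=1}^m\subset\mathcal{H}$ is Bessel if there is $b>0$ with $\sum_{i=1}^m|\langle f,f_i\rangle|^2\le b\|f\|^2$ for all $f\in\mathcal{H}$; its frame operator is the positive semi-definite operator $Sf=\sum_{i=1}^m\langle f,f_i\rangle f_i$. It is a frame for $\mathcal{H}$ if in addition there is $a>0$ with $a\|f\|^2\le\sum_{i=1}^m|\langle f,f_i\rangle|^2$ for all $f$. It is a tight frame if for some $c>0$ one has $\sum_{i=1}^m|\langle f,f_i\rangle|^2=c\|f\|^2$ for all $f$, equivalently its frame operator is $cI$. $\mathcal{F}\cup\mathcal{G}$ denotes the concatenated sequence (counting repetitions), so its frame operator is $S^{\mathcal{F}}+S^{\mathcal{G}}$. *)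

theory Defs
  imports Complex_Main "HOL-Library.Extended_Nat" "HOL-Analysis.Infinite_Sum"
begin

text \<open>
  Scalar fields \<open>\<real>\<close> and \<open>\<complex>\<close>, treated uniformly. \<open>scnj\<close> is the conjugation of the scalar
  field (the identity on \<open>\<real>\<close>). By the lemma \<open>real_or_complex_cases\<close> below there are no
  instances other than \<open>\<real>\<close> and \<open>\<complex>\<close>, up to isomorphism.
\<close>

class real_or_complex = real_normed_field +
  fixes scnj :: "'a \<Rightarrow> 'a"
  assumes scnj_add: "scnj (x + y) = scnj x + scnj y"
    and scnj_mult: "scnj (x * y) = scnj x * scnj y"
    and scnj_scnj: "scnj (scnj x) = x"
    and mult_scnj_scaleR: "x * scnj x = (norm x)\<^sup>2 *\<^sub>R 1"

instantiation real :: real_or_complex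
begin
definition scnj_real :: "real \<Rightarrow> real" where "scnj_real x = x"
instance
  by standard (simp_all add: scnj_real_def power2_eq_square)
end

instantiation complex :: real_or_complex
begin
definition scnj_complex :: "complex \<Rightarrow> complex" where "scnj_complex = cnj"
instance
  by standard (simp_all add: scnj_complex_def complex_norm_square[symmetric] scaleR_conv_of_real)
end

lemma mult_scnj: "x * scnj x = of_real ((norm x)\<^sup>2)" for x :: "'k::real_or_complex"
  by (simp add: mult_scnj_scaleR of_real_def)

lemma add_scnj_real: "x + scnj x \<in> \<real>" for x :: "'k::real_or_complex"
proof -
  have one: "scnj (1::'k) = 1"
    using mult_scnj[of "1::'k"] by simp
  have "(x + 1) * (scnj x + 1) = of_real ((norm (x + 1))\<^sup>2)"
    using mult_scnj[of "x + 1"] by (simp add: scnj_add one)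
  then have "x + scnj x = of_real ((norm (x + 1))\<^sup>2 - (norm x)\<^sup>2 - 1)"
    using mult_scnj[of x] by (simp add: algebra_simps)
  then show ?thesis by simp
qed

lemma real_or_complex_cases:
  "(\<forall>x::'k::real_or_complex. x \<in> \<real>) \<or>
   (\<exists>i::'k. i * i = -1 \<and> (\<forall>x. \<exists>s t. x = of_real s + of_real t * i))"
proof (cases "\<forall>x::'k. x \<in> \<real>")
  case False
  then obtain x :: 'k where x: "x \<notin> \<real>" by blast
  define y where "y = x - scnj x"
  have zero: "scnj (0::'k) = 0"
    using scnj_add[of "0::'k" 0] by simp
  have minus: "scnj (- z) = - scnj z" for z :: 'k
    using scnj_add[of z "-z"] zero by (simp add: eq_neg_iff_add_eq_0 add.commute)
  have skew: "scnj (z - scnj z) = - (z - scnj z)" for z :: 'k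
    using scnj_add[of z "- scnj z"] by (simp add: minus scnj_scnj)
  have fixed: "z \<in> \<real>" if "scnj z = z" for z :: 'k
  proof -
    have "z = (z + scnj z) / 2" using that by simp
    then show ?thesis using add_scnj_real[of z] by (metis Reals_divide Reals_numeral)
  qed
  have y0: "y \<noteq> 0" using x fixed[of x] by (auto simp: y_def)
  define i where "i = y / of_real (norm y)"
  have yy: "y * y = - of_real ((norm y)\<^sup>2)"
    using mult_scnj[of y] skew[of x] unfolding y_def[symmetric]
    by (metis minus_minus mult_minus_right)
  have "i * i = (y * y) / of_real ((norm y)\<^sup>2)"
    by (simp add: i_def power2_eq_square)
  then have ii: "i * i = -1" using y0 by (simp add: yy)
  have "\<exists>s t. z = of_real s + of_real t * i" for z
  proof -
    define w where "w = z - scnj z"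
    have "scnj (w * y) = w * y"
      using skew[of z] skew[of x] by (simp add: scnj_mult w_def[symmetric] y_def[symmetric])
    then obtain u where u: "w * y = of_real u" using fixed by (metis Reals_cases)
    obtain v where v: "z + scnj z = of_real v" using add_scnj_real by (metis Reals_cases)
    have "w * i = of_real (u / norm y)" by (simp add: i_def u)
    then have "w * (i * i) = of_real (u / norm y) * i" by (metis mult.assoc)
    then have w: "w = of_real (- (u / norm y)) * i"
      by (metis ii minus_minus mult_minus_right mult_1_right mult_minus_left of_real_minus)
    have "z = ((z + scnj z) + w) / 2" by (simp add: w_def)
    also have "\<dots> = of_real (v / 2) + of_real (- (u / norm y) / 2) * i"
      unfolding v w by (simp add: add_divide_distrib)
    finally show ?thesis by blast
  qed
  with ii show ?thesis by blast
qed simp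

text \<open>
  The inner product is linear in its first argument. All spaces considered below have finite
  dimension, so completeness is automatic.
\<close>

locale inner_product_space = vector_space smul
  for smul :: "'k::real_or_complex \<Rightarrow> 'v::ab_group_add \<Rightarrow> 'v" +
  fixes ip :: "'v \<Rightarrow> 'v \<Rightarrow> 'k"
  assumes ip_add_left: "ip (x + y) z = ip x z + ip y z"
    and ip_scale_left: "ip (smul c x) y = c * ip x y"
    and ip_commute: "ip y x = scnj (ip x y)"
    and ip_self_nonneg: "\<exists>t\<ge>0. ip x x = of_real t"
    and ip_self_eq_0: "ip x x = 0 \<Longrightarrow> x = 0"

text \<open>\<open>ip x x\<close> is a nonnegative real scalar, so its absolute value is its value as a real.\<close>

definition ip_norm :: "('v \<Rightarrow> 'v \<Rightarrow> 'k::real_or_complex) \<Rightarrow> 'v \<Rightarrow> real" where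
  "ip_norm ip x = sqrt (norm (ip x x))"

text \<open>
  A sequence of length \<open>m \<in> \<nat> \<union> {\<infinity>}\<close> is a function on \<open>nat\<close> of which only the values at the
  indices \<open>i\<close> with \<open>1 \<le> i \<le> m\<close> matter.
\<close>

definition seq_idx :: "enat \<Rightarrow> nat set" where
  "seq_idx m = {i. 1 \<le> i \<and> enat i \<le> m}"

definition bessel_seq :: "('v \<Rightarrow> 'v \<Rightarrow> 'k::real_or_complex) \<Rightarrow> enat \<Rightarrow> (nat \<Rightarrow> 'v) \<Rightarrow> bool" where
  "bessel_seq ip m f \<longleftrightarrow> (\<exists>b>0. \<forall>x.
     (\<lambda>i. (norm (ip x (f i)))\<^sup>2) summable_on seq_idx m \<and>
     (\<Sum>\<^sub>\<infinity>i\<in>seq_idx m. (norm (ip x (f i)))\<^sup>2) \<le> b * (ip_norm ip x)\<^sup>2)"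

definition tight_frame :: "('v \<Rightarrow> 'v \<Rightarrow> 'k::real_or_complex) \<Rightarrow> enat \<Rightarrow> (nat \<Rightarrow> 'v) \<Rightarrow> bool" where
  "tight_frame ip m f \<longleftrightarrow> (\<exists>c>0. \<forall>x.
     ((\<lambda>i. (norm (ip x (f i)))\<^sup>2) has_sum c * (ip_norm ip x)\<^sup>2) (seq_idx m))"

definition seq_concat :: "nat \<Rightarrow> (nat \<Rightarrow> 'v) \<Rightarrow> (nat \<Rightarrow> 'v) \<Rightarrow> nat \<Rightarrow> 'v" where
  "seq_concat p f g i = (if i \<le> p then f i else g (i - p))"

definition frame_operator ::
  "('k::real_or_complex \<Rightarrow> 'v::ab_group_add \<Rightarrow> 'v) \<Rightarrow> ('v \<Rightarrow> 'v \<Rightarrow> 'k) \<Rightarrow> nat \<Rightarrow> (nat \<Rightarrow> 'v) \<Rightarrow> 'v \<Rightarrow> 'v"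
  where "frame_operator smul ip p f x = (\<Sum>i=1..p. smul (ip x (f i)) (f i))"

text \<open>
  The trace of the matrix of \<open>T\<close> with respect to a basis of the space: \<open>extend_basis {}\<close> is some
  basis of the whole space, and the value does not depend on the choice.
\<close>

definition operator_trace :: "('k::field \<Rightarrow> 'v::ab_group_add \<Rightarrow> 'v) \<Rightarrow> ('v \<Rightarrow> 'v) \<Rightarrow> 'k" where
  "operator_trace smul T =
     (\<Sum>b\<in>vector_space.extend_basis smul {}.
        module.representation smul (vector_space.extend_basis smul {}) (T b) b)"

text \<open>
  \<open>\<lambda>\<^sub>1 \<ge> \<dots> \<ge> \<lambda>\<^sub>n\<close> lists the eigenvalues of \<open>T\<close>, every scalar \<open>t\<close> occurring as often as the dimension
  of its eigenspace (\<open>0\<close> times if it is not an eigenvalue). The operators it is applied to are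
  self-adjoint, so that geometric and algebraic multiplicity agree.
\<close>

definition ordered_eigenvalues ::
  "('k::real_or_complex \<Rightarrow> 'v::ab_group_add \<Rightarrow> 'v) \<Rightarrow> ('v \<Rightarrow> 'v) \<Rightarrow> nat \<Rightarrow> (nat \<Rightarrow> real) \<Rightarrow> bool" where
  "ordered_eigenvalues smul T n l \<longleftrightarrow>
     antimono_on {1..n} l \<and>
     (\<forall>t. card {i\<in>{1..n}. of_real (l i) = t} = vector_space.dim smul {x. T x = smul t x})"

end

theory Submission imports Defs begin

text \<open>
  The union of \<open>f\<close> and \<open>g\<close> is tight with constant \<open>c\<close> exactly when the frame operator of \<open>g\<close> is
  \<open>c I - S\<close>, where \<open>S\<close> is the frame operator of \<open>f\<close>. In an eigenbasis of \<open>S\<close> this operator is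
  diagonal with entries \<open>\<mu>\<^sub>1 \<ge> \<dots> \<ge> \<mu>\<^sub>n\<close>, \<open>\<mu>\<^sub>i = c - \<lambda>\<^sub>n\<^sub>-\<^sub>i\<^sub>+\<^sub>1\<close>; comparing traces forces
  \<open>c = (\<Sum>a\<^sub>i + \<alpha>) / n\<close>. So the question is which norms are possible for a sequence with a
  prescribed positive semi-definite frame operator, and the answer is of Schur-Horn type: the squared
  norms must be majorized by the eigenvalues. Rearranged, that is the condition of the theorem.

  Necessity (\<open>sum_norms_le_sum_eigenvalues\<close>): the first \<open>k\<close> vectors span a space of dimension at
  most \<open>k\<close>, and their squared norms add up to at most the trace of the compression of the operator
  to that space, which is at most \<open>\<mu>\<^sub>1 + \<dots> + \<mu>\<^sub>k\<close> (\<open>sum_mult_le_sum_top\<close>).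

  Sufficiency: the operator is the frame operator of the orthogonal vectors \<open>\<surd>\<mu>\<^sub>i e\<^sub>i\<close>.
  Rotating two orthogonal vectors in their plane does not change their joint frame operator but
  lets one of the two take any squared norm between the two given ones
  (\<open>split_orthogonal_pair\<close>). Applied to neighbours whose squared norms enclose \<open>a\<^sub>1\<close>, this
  produces a vector of squared norm \<open>a\<^sub>1\<close> and again an orthogonal family, which majorizes
  \<open>a\<^sub>2, a\<^sub>3, \<dots>\<close> (\<open>peel_off_vector\<close>). Iterating gives a sequence with the required norms; the
  trace left over after \<open>m\<close> steps is the tail of \<open>\<Sum>a\<^sub>i\<close>, so it tends to \<open>0\<close>, and
  the whole operator is exhausted (\<open>orthogonal_majorant_realization\<close>).

  A finite sequence is treated as an infinite one padded by zeros, so that both parts of the theorem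
  are instances of one statement about a length in \<open>\<nat> \<union> {\<infinity>}\<close> (\<open>tight_completion_iff\<close>). An
  orthonormal eigenbasis of \<open>S\<close> exists because the multiplicities of the given eigenvalues add up to
  the dimension (\<open>eigenbasis\<close>).
\<close>

section \<open>Conjugation of scalars\<close>

lemma scnj_0 [simp]: "scnj (0::'k::real_or_complex) = 0"
  using scnj_add[of "0::'k" 0] by simp

lemma scnj_of_real [simp]: "scnj (of_real r :: 'k::real_or_complex) = of_real r"
proof (cases "r = 0")
  case False
  have "(of_real r :: 'k) * scnj (of_real r) = of_real r * of_real r"
    using mult_scnj[of "of_real r :: 'k"] by (simp add: power2_eq_square)
  then show ?thesis using False by simp
qed simp

lemma norm_scnj [simp]: "norm (scnj x) = norm (x::'k::real_or_complex)"
proof (cases "x = 0")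
  case False
  have "norm (x * scnj x) = (norm x)\<^sup>2"
    unfolding mult_scnj norm_of_real by simp
  then show ?thesis using False by (simp add: norm_mult power2_eq_square)
qed simp

section \<open>Two facts about finite sums\<close>

text \<open>
  Under the constraints on the weights, the weighted sum is largest if all the weight sits on the
  first \<open>k\<close> indices. Subtracting the threshold \<open>\<tau> = \<mu> (k - 1)\<close> from \<open>\<mu>\<close> makes this hold term by
  term: where \<open>\<mu> - \<tau>\<close> is positive the weight can only be below the optimal \<open>1\<close>, elsewhere only
  above the optimal \<open>0\<close>.
\<close>

lemma sum_mult_le_sum_top:
  fixes \<mu> w :: "nat \<Rightarrow> real"
  assumes anti: "antimono_on {..<n} \<mu>" and nonneg: "\<And>i. i < n \<Longrightarrow> \<mu> i \<ge> 0"
    and w: "\<And>i. i < n \<Longrightarrow> 0 \<le> w i \<and> w i \<le> 1" and sum_w: "(\<Sum>i<n. w i) \<le> real k" and "k \<le> n"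
  shows "(\<Sum>i<n. \<mu> i * w i) \<le> (\<Sum>i<k. \<mu> i)"
proof (cases k)
  case 0
  then have "(\<Sum>i<n. w i) = 0" using sum_w w by (intro antisym sum_nonneg) auto
  then have "\<forall>i\<in>{..<n}. w i = 0" using w by (subst (asm) sum_nonneg_eq_0_iff) auto
  then show ?thesis using 0 by simp
next
  case (Suc k')
  define \<tau> where "\<tau> = \<mu> k'"
  define \<chi> where "\<chi> = (\<lambda>i. if i < k then 1 else 0 :: real)"
  have \<tau>: "\<tau> \<ge> 0" using nonneg Suc \<open>k \<le> n\<close> by (simp add: \<tau>_def)
  have ind: "(\<Sum>i<n. h i * \<chi> i) = (\<Sum>i<k. h i)" for h
    unfolding \<chi>_def using \<open>k \<le> n\<close> by (intro sum.mono_neutral_cong_right) auto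
  have "(\<mu> i - \<tau>) * (w i - \<chi> i) \<le> 0" if "i < n" for i
  proof (cases "i < k")
    case True
    then have "\<mu> i \<ge> \<tau>" using Suc that \<open>k \<le> n\<close> unfolding \<tau>_def
      by (intro monotone_onD[OF anti]) auto
    then show ?thesis using w[OF that] True by (auto simp: \<chi>_def mult_le_0_iff)
  next
    case False
    then have "\<mu> i \<le> \<tau>" using Suc that \<open>k \<le> n\<close> unfolding \<tau>_def
      by (intro monotone_onD[OF anti, of k' i]) auto
    then show ?thesis using w[OF that] False by (auto simp: \<chi>_def mult_le_0_iff)
  qed
  then have "(\<Sum>i<n. (\<mu> i - \<tau>) * (w i - \<chi> i)) \<le> 0" by (intro sum_nonpos) auto
  also have "(\<Sum>i<n. (\<mu> i - \<tau>) * (w i - \<chi> i))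
      = (\<Sum>i<n. \<mu> i * w i) - (\<Sum>i<n. \<mu> i * \<chi> i) - \<tau> * ((\<Sum>i<n. w i) - (\<Sum>i<n. 1 * \<chi> i))"
    by (simp add: algebra_simps sum.distrib sum_subtractf sum_distrib_left)
  also have "\<dots> = (\<Sum>i<n. \<mu> i * w i) - (\<Sum>i<k. \<mu> i) - \<tau> * ((\<Sum>i<n. w i) - real k)"
    by (simp only: ind) simp
  finally have "(\<Sum>i<n. \<mu> i * w i) - (\<Sum>i<k. \<mu> i) \<le> \<tau> * ((\<Sum>i<n. w i) - real k)" by simp
  also have "\<dots> \<le> 0" using \<tau> sum_w by (simp add: mult_le_0_iff)
  finally show ?thesis by simp
qed

text \<open>
  Bookkeeping for the construction below: one step replaces the entries \<open>j\<close> and \<open>j + 1\<close> of a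
  sequence by one entry, at the cost of \<open>c\<close>, and moves up the later ones.
\<close>

lemma sum_merge_adjacent:
  fixes F F' :: "nat \<Rightarrow> 'a::ab_group_add"
  assumes below: "\<And>i. i < j \<Longrightarrow> F' i = F i" and at: "F' j + c = F j + F (Suc j)"
    and above: "\<And>i. i > j \<Longrightarrow> F' i = F (Suc i)" and "j < k"
  shows "(\<Sum>i<k. F' i) + c = (\<Sum>i<Suc k. F i)"
  using \<open>j < k\<close>
proof (induction k)
  case (Suc k)
  show ?case
  proof (cases "k = j")
    case True
    then have "(\<Sum>i<k. F' i) = (\<Sum>i<k. F i)" using below by simp
    then show ?thesis using True at by (simp add: algebra_simps)
  next
    case False
    then have "(\<Sum>i<k. F' i) + c = (\<Sum>i<Suc k. F i)" using Suc by simp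
    then show ?thesis using above[of k] False Suc.prems by (simp add: algebra_simps)
  qed
qed simp

section \<open>Orthonormal families\<close>

context inner_product_space
begin

lemma ip_zero_left [simp]: "ip 0 y = 0"
  using ip_add_left[of 0 0 y] by simp

lemma ip_zero_right [simp]: "ip x 0 = 0"
  using ip_commute[of x 0] by simp

lemma ip_add_right: "ip x (y + z) = ip x y + ip x z"
  by (metis ip_commute ip_add_left scnj_add)

lemma ip_scale_right: "ip x (smul c y) = scnj c * ip x y"
  by (metis ip_commute ip_scale_left scnj_mult)

lemma ip_minus_left: "ip (- x) y = - ip x y"
  using ip_add_left[of "-x" x y] by (simp add: eq_neg_iff_add_eq_0)

lemma ip_diff_left: "ip (x - y) z = ip x z - ip y z"
  using ip_add_left[of x "-y" z] by (simp add: ip_minus_left)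

lemma ip_minus_right: "ip x (- y) = - ip x y"
  using ip_add_right[of x "-y" y] by (simp add: eq_neg_iff_add_eq_0)

lemma ip_diff_right: "ip x (y - z) = ip x y - ip x z"
  using ip_add_right[of x y "-z"] by (simp add: ip_minus_right)

lemma ip_sum_left: "ip (\<Sum>i\<in>I. x i) y = (\<Sum>i\<in>I. ip (x i) y)"
  by (induction I rule: infinite_finite_induct) (simp_all add: ip_add_left)

lemma ip_sum_right: "ip x (\<Sum>i\<in>I. y i) = (\<Sum>i\<in>I. ip x (y i))"
  by (induction I rule: infinite_finite_induct) (simp_all add: ip_add_right)

lemma norm_ip_commute: "norm (ip y x) = norm (ip x y)"
  by (metis ip_commute norm_scnj)

lemma ip_eq_0_commute: "ip x y = 0 \<longleftrightarrow> ip y x = 0"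
  by (metis norm_ip_commute norm_eq_zero)

lemma ip_norm_sq: "(ip_norm ip x)\<^sup>2 = norm (ip x x)"
  by (simp add: ip_norm_def)

lemma ip_self: "ip x x = of_real ((ip_norm ip x)\<^sup>2)"
  using ip_self_nonneg[of x] by (auto simp: ip_norm_sq)

lemma ip_norm_eq_0: "(ip_norm ip x)\<^sup>2 = 0 \<longleftrightarrow> x = 0"
  using ip_self_eq_0[of x] by (auto simp: ip_norm_sq)

definition orthonormal :: "'i set \<Rightarrow> ('i \<Rightarrow> 'v) \<Rightarrow> bool" where
  "orthonormal I e \<longleftrightarrow> (\<forall>i\<in>I. \<forall>j\<in>I. ip (e i) (e j) = (if i = j then 1 else 0))"

lemma orthonormalD: "orthonormal I e \<Longrightarrow> i \<in> I \<Longrightarrow> j \<in> I \<Longrightarrow> ip (e i) (e j) = (if i = j then 1 else 0)"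
  by (simp add: orthonormal_def)

lemma ip_sum_orthonormal:
  assumes "orthonormal I e" "finite I" "j \<in> I"
  shows "ip (\<Sum>i\<in>I. smul (c i) (e i)) (e j) = c j"
proof -
  have "ip (\<Sum>i\<in>I. smul (c i) (e i)) (e j) = (\<Sum>i\<in>I. if i = j then c i else 0)"
    using assms unfolding ip_sum_left ip_scale_left by (intro sum.cong) (auto simp: orthonormalD)
  then show ?thesis using assms by simp
qed

lemma orthonormal_inj_on: "orthonormal I e \<Longrightarrow> inj_on e I"
  by (metis inj_onI orthonormalD zero_neq_one)

lemma orthonormal_image: "orthonormal I e \<Longrightarrow> orthonormal (e ` I) (\<lambda>u. u)"
  using orthonormal_inj_on[of I e] by (auto simp: orthonormal_def inj_on_def)

lemma orthonormal_independent:
  assumes "orthonormal U (\<lambda>u. u)"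
  shows "independent U"
  unfolding dependent_explicit
proof clarsimp
  fix S c v
  assume S: "finite S" "S \<subseteq> U" "(\<Sum>v\<in>S. smul (c v) v) = 0" "v \<in> S"
  have "orthonormal S (\<lambda>u. u)" using assms S(2) unfolding orthonormal_def by blast
  then show "c v = 0" using ip_sum_orthonormal[of S "\<lambda>u. u" v c] S by simp
qed

lemma orthonormal_expansion:
  assumes on: "orthonormal I e" and fin: "finite I" and x: "x \<in> span (e ` I)"
  shows "x = (\<Sum>i\<in>I. smul (ip x (e i)) (e i))"
  using x
proof (induction rule: span_induct_alt)
  case (step c y z)
  then obtain j where j: "j \<in> I" "y = e j" by auto
  have "(\<Sum>i\<in>I. smul (ip y (e i)) (e i)) = (\<Sum>i\<in>I. if i = j then e i else 0)"
    using j on by (auto simp: orthonormalD intro!: sum.cong)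
  then have "(\<Sum>i\<in>I. smul (ip y (e i)) (e i)) = y" using j fin by simp
  moreover have "(\<Sum>i\<in>I. smul (ip (smul c y + z) (e i)) (e i))
      = smul c (\<Sum>i\<in>I. smul (ip y (e i)) (e i)) + (\<Sum>i\<in>I. smul (ip z (e i)) (e i))"
    by (simp add: ip_add_left ip_scale_left scale_left_distrib sum.distrib scale_sum_right)
  ultimately show ?case using step by simp
qed simp

lemma pythagoras_projection:
  assumes "orthonormal I e" "finite I"
  shows "(ip_norm ip x)\<^sup>2 =
    (ip_norm ip (x - (\<Sum>i\<in>I. smul (ip x (e i)) (e i))))\<^sup>2 + (\<Sum>i\<in>I. (norm (ip x (e i)))\<^sup>2)"
proof -
  define P where "P = (\<Sum>i\<in>I. smul (ip x (e i)) (e i))"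
  have "ip (x - P) (e j) = 0" if "j \<in> I" for j
    using ip_sum_orthonormal[OF assms that] by (simp add: P_def ip_diff_left)
  then have "ip (x - P) (\<Sum>i\<in>I. smul (ip x (e i)) (e i)) = 0"
    by (simp add: ip_sum_right ip_scale_right)
  then have orth: "ip (x - P) P = 0" by (simp add: P_def)
  have "ip x P = of_real (\<Sum>i\<in>I. (norm (ip x (e i)))\<^sup>2)"
    by (simp add: P_def ip_sum_right ip_scale_right) (simp add: mult.commute[of "scnj _"] mult_scnj)
  moreover have "ip (x - P) (x - P) = ip x x - ip x P"
  proof -
    have "ip P x = ip P P" using orth ip_eq_0_commute[of "x - P" P] by (simp add: ip_diff_right)
    then show ?thesis using orth by (simp add: ip_diff_right ip_diff_left)
  qed
  ultimately have "(of_real ((ip_norm ip (x - P))\<^sup>2) :: 'k)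
      = of_real ((ip_norm ip x)\<^sup>2 - (\<Sum>i\<in>I. (norm (ip x (e i)))\<^sup>2))"
    by (simp only: ip_self of_real_diff)
  then show ?thesis unfolding P_def[symmetric] of_real_eq_iff by simp
qed

lemma bessel_inequality:
  "orthonormal I e \<Longrightarrow> finite I \<Longrightarrow> (\<Sum>i\<in>I. (norm (ip x (e i)))\<^sup>2) \<le> (ip_norm ip x)\<^sup>2"
  using pythagoras_projection[of I e x] by simp

lemma parseval:
  "orthonormal I e \<Longrightarrow> finite I \<Longrightarrow> x \<in> span (e ` I) \<Longrightarrow>
    (ip_norm ip x)\<^sup>2 = (\<Sum>i\<in>I. (norm (ip x (e i)))\<^sup>2)"
  using pythagoras_projection[of I e x] orthonormal_expansion[of I e x]
    ip_norm_eq_0[of "x - (\<Sum>i\<in>I. smul (ip x (e i)) (e i))"] by simp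

lemma ip_norm_scale_sq: "(ip_norm ip (smul c x))\<^sup>2 = (norm c)\<^sup>2 * (ip_norm ip x)\<^sup>2"
  unfolding ip_norm_sq by (simp add: ip_scale_left ip_scale_right norm_mult power2_eq_square)

lemma orthonormal_normalize:
  assumes "y \<noteq> 0"
  shows "ip (smul (of_real (1 / ip_norm ip y)) y) (smul (of_real (1 / ip_norm ip y)) y) = 1"
proof -
  have "ip_norm ip y \<noteq> 0" using assms ip_norm_eq_0[of y] by simp
  then show ?thesis by (subst ip_self) (simp add: ip_norm_scale_sq power_divide norm_divide)
qed

lemma cauchy_schwarz: "(norm (ip x y))\<^sup>2 \<le> (ip_norm ip x)\<^sup>2 * (ip_norm ip y)\<^sup>2"
proof (cases "y = 0")
  case False
  define u where "u = smul (of_real (1 / ip_norm ip y)) y"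
  have "ip_norm ip y \<noteq> 0" using False ip_norm_eq_0[of y] by simp
  moreover have "(norm (ip x u))\<^sup>2 \<le> (ip_norm ip x)\<^sup>2"
    using bessel_inequality[of "{u}" "\<lambda>u. u" x] orthonormal_normalize[OF False]
    by (simp add: orthonormal_def u_def)
  ultimately show ?thesis
    by (simp add: u_def ip_scale_right norm_mult norm_divide power_divide power_mult_distrib field_simps)
qed simp

text \<open>
  Gram-Schmidt for possibly dependent vectors: a vector in the span of the earlier ones leaves
  nothing to normalize and is skipped, whence only an inequality between the cardinalities.
\<close>

lemma gram_schmidt:
  assumes "finite B"
  shows "\<exists>U. finite U \<and> card U \<le> card B \<and> orthonormal U (\<lambda>u. u) \<and> span U = span B"
  using assms
proof (induction B)
  case empty
  show ?case by (intro exI[of _ "{}"]) (simp add: orthonormal_def)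
next
  case (insert b B)
  then obtain U where U: "finite U" "card U \<le> card B" "orthonormal U (\<lambda>u. u)" "span U = span B"
    by blast
  define P where "P = (\<Sum>u\<in>U. smul (ip b u) u)"
  define y where "y = b - P"
  have P: "P \<in> span U" unfolding P_def by (intro span_sum span_scale span_base)
  have orth: "ip y u = 0" if "u \<in> U" for u
    using ip_sum_orthonormal[OF U(3,1) that, of "ip b"] by (simp add: y_def P_def ip_diff_left)
  show ?case
  proof (cases "y = 0")
    case True
    then have "b \<in> span B" using P U by (simp add: y_def)
    then show ?thesis using U insert.hyps by (intro exI[of _ U]) (auto simp: span_redundant)
  next
    case False
    define u where "u = smul (of_real (1 / ip_norm ip y)) y"
    have ny: "ip_norm ip y \<noteq> 0" using False ip_norm_eq_0[of y] by simp
    have "orthonormal (insert u U) (\<lambda>u. u)"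
    proof -
      have 1: "ip u u = 1" using orthonormal_normalize[OF False] by (simp add: u_def)
      have 2: "ip u v = 0" "ip v u = 0" if "v \<in> U" for v
      proof -
        show "ip u v = 0" using orth[OF that] by (simp add: u_def ip_scale_left)
        then show "ip v u = 0" by (simp add: ip_eq_0_commute)
      qed
      show ?thesis using 1 2 U(3) unfolding orthonormal_def by fastforce
    qed
    moreover have "span (insert u U) = span (insert b B)"
    proof -
      have b: "b = smul (of_real (ip_norm ip y)) u + P"
        using ny by (simp add: u_def y_def flip: of_real_mult)
      have "U \<subseteq> span (insert b B)" "B \<subseteq> span (insert u U)"
        using U(4) span_superset[of U] span_superset[of B] span_mono[of B "insert b B"]
          span_mono[of U "insert u U"] by blast+
      moreover have "P \<in> span (insert b B)" "P \<in> span (insert u U)"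
        using P U(4) span_mono[of B "insert b B"] span_mono[of U "insert u U"] by blast+
      then have "u \<in> span (insert b B)" "b \<in> span (insert u U)"
        by (metis u_def y_def insertI1 span_base span_diff span_scale)
           (use \<open>P \<in> span (insert u U)\<close> in \<open>metis b insertI1 span_base span_add span_scale\<close>)
      ultimately show ?thesis by (subst span_eq) simp
    qed
    moreover have "card (insert u U) \<le> card (insert b B)"
      using U insert.hyps by (simp add: card_insert_if)
    ultimately show ?thesis using U by (intro exI[of _ "insert u U"]) simp
  qed
qed

end

section \<open>Eigenbases and frame operators\<close>

context inner_product_space
begin

text \<open>
  Eigenspaces of a self-adjoint operator for different real eigenvalues are orthogonal, so
  orthonormal bases of the eigenspaces combine to an orthonormal family. As the dimensions of the
  eigenspaces are the multiplicities in the list \<open>l\<close>, this family can be indexed by \<open>{1..n}\<close>,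
  and having \<open>n\<close> members it spans the whole space.
\<close>

lemma eigenbasis:
  assumes lin: "Vector_Spaces.linear smul smul T" and self_adjoint: "\<And>x y. ip (T x) y = ip x (T y)"
    and dim: "dim (UNIV :: 'v set) = n" "n \<ge> 1" and eig: "ordered_eigenvalues smul T n l"
  obtains e where "orthonormal {1..n} e" "span (e ` {1..n}) = UNIV"
    "\<And>i. i \<in> {1..n} \<Longrightarrow> T (e i) = smul (of_real (l i)) (e i)"
proof -
  interpret T: Vector_Spaces.linear smul smul T by (rule lin)
  obtain B0 where B0: "independent B0" "UNIV \<subseteq> span B0" "card B0 = n"
    using basis_exists[of UNIV] dim by auto
  have "finite B0" using B0(3) dim(2) by (intro card_ge_0_finite) simp
  then have bound: "finite S \<and> card S \<le> n" if "independent S" for S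
    using independent_span_bound[of B0 S] that B0 by auto
  define E where "E t = {x. T x = smul t x}" for t
  define I where "I t = {i\<in>{1..n}. of_real (l i) = t}" for t :: 'k
  have card_I: "card (I t) = dim (E t)" for t
    using eig by (simp add: ordered_eigenvalues_def E_def I_def)
  \<comment> \<open>\<open>\<beta>\<close> attaches an orthonormal basis of the eigenspace of \<open>t\<close> to the positions at which \<open>t\<close> is listed.\<close>
  have "\<exists>\<beta>. bij_betw \<beta> (I t) (\<beta> ` I t) \<and> orthonormal (\<beta> ` I t) (\<lambda>u. u) \<and> \<beta> ` I t \<subseteq> E t" for t
  proof -
    have sub: "subspace (E t)"
      by (auto simp: subspace_def E_def T.zero T.add T.scale scale_right_distrib mult.commute)
    obtain B where B: "B \<subseteq> E t" "independent B" "E t \<subseteq> span B" "card B = dim (E t)"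
      using basis_exists by blast
    have "span B = E t" using B sub by (metis span_minimal subset_antisym)
    then obtain U where U: "finite U" "orthonormal U (\<lambda>u. u)" "span U = E t"
      using gram_schmidt[of B] bound[OF B(2)] by auto
    have "span U = span (E t)" using U(3) sub by (metis span_span)
    then have "card U = dim (E t)"
      using orthonormal_independent[OF U(2)] by (metis dim_eq_card)
    then obtain \<beta> where "bij_betw \<beta> (I t) U"
      using finite_same_card_bij[of "I t" U] card_I[of t] U(1) by (auto simp: I_def)
    then show ?thesis using U span_superset[of U]
      by (intro exI[of _ \<beta>]) (auto simp: bij_betw_def)
  qed
  then obtain \<beta> where \<beta>: "\<And>t. inj_on (\<beta> t) (I t)" "\<And>t. orthonormal (\<beta> t ` I t) (\<lambda>u. u)"
      "\<And>t. \<beta> t ` I t \<subseteq> E t"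
    by (auto simp: bij_betw_def) metis
  define e where "e i = \<beta> (of_real (l i)) i" for i
  have eI: "i \<in> I (of_real (l i))" if "i \<in> {1..n}" for i using that by (simp add: I_def)
  have Te: "T (e i) = smul (of_real (l i)) (e i)" if "i \<in> {1..n}" for i
    using \<beta>(3)[of "of_real (l i)"] eI[OF that] by (auto simp: E_def e_def)
  have on: "orthonormal {1..n} e"
    unfolding orthonormal_def
  proof safe
    fix i j assume ij: "i \<in> {1..n}" "j \<in> {1..n}"
    show "ip (e i) (e j) = (if i = j then 1 else 0)"
    proof (cases "l i = l j")
      case True
      then have "i \<in> I (of_real (l i))" "j \<in> I (of_real (l i))" using ij by (auto simp: I_def)
      then show ?thesis
        using orthonormalD[OF \<beta>(2), of "e i" "of_real (l i)" "e j"] inj_onD[OF \<beta>(1), of "of_real (l i)" i j]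
        by (auto simp: e_def True)
    next
      case False
      have "of_real (l i) * ip (e i) (e j) = of_real (l j) * ip (e i) (e j)"
        using self_adjoint[of "e i" "e j"] Te[OF ij(1)] Te[OF ij(2)]
        by (simp add: ip_scale_left ip_scale_right)
      then show ?thesis using False by auto
    qed
  qed
  have "span (e ` {1..n}) = UNIV"
  proof (rule ccontr)
    assume "span (e ` {1..n}) \<noteq> UNIV"
    then obtain x where x: "x \<notin> span (e ` {1..n})" by blast
    have "independent (insert x (e ` {1..n}))"
      using x orthonormal_independent[OF orthonormal_image[OF on]] by (rule independent_insertI)
    moreover have "card (insert x (e ` {1..n})) = Suc n"
      using x span_base[of x "e ` {1..n}"] card_image[OF orthonormal_inj_on[OF on]]
      by (subst card_insert_disjoint) auto
    ultimately show False using bound by fastforce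
  qed
  with on Te that show thesis by blast
qed

lemma eigenbasis_apply:
  assumes lin: "Vector_Spaces.linear smul smul T"
    and on: "orthonormal I e" and fin: "finite I" and span: "span (e ` I) = UNIV"
    and eig: "\<And>i. i \<in> I \<Longrightarrow> T (e i) = smul (of_real (l i)) (e i)"
  shows "T x = (\<Sum>i\<in>I. smul (ip x (e i) * of_real (l i)) (e i))"
proof -
  interpret T: Vector_Spaces.linear smul smul T by (rule lin)
  have "T x = T (\<Sum>i\<in>I. smul (ip x (e i)) (e i))"
    using orthonormal_expansion[OF on fin, of x] span by simp
  then show ?thesis by (simp add: T.sum T.scale eig)
qed

text \<open>
  The trace is defined through some basis \<open>B\<close>, which is unrelated to the eigenbasis. Expanding
  \<open>T b\<close> in the eigenbasis and the eigenvectors in \<open>B\<close>, and exchanging the sums, collects for every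
  \<open>i\<close> the \<open>B\<close>-expansion of \<open>e i\<close> paired with \<open>e i\<close>, which is \<open>1\<close>.
\<close>

lemma operator_trace_eigenbasis:
  assumes lin: "Vector_Spaces.linear smul smul T"
    and on: "orthonormal I e" and fin: "finite I" and span: "span (e ` I) = UNIV"
    and eig: "\<And>i. i \<in> I \<Longrightarrow> T (e i) = smul (of_real (l i)) (e i)"
  shows "operator_trace smul T = of_real (\<Sum>i\<in>I. l i)"
proof -
  define B where "B = extend_basis {}"
  have B: "independent B" "span B = UNIV"
    using independent_extend_basis[of "{}"] span_extend_basis[of "{}"] independent_empty
    unfolding B_def by blast+
  have finB: "finite B"
    using independent_span_bound[of "e ` I" B] B fin span by auto
  have "operator_trace smul T = (\<Sum>b\<in>B. representation B (T b) b)"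
    by (simp add: operator_trace_def B_def)
  also have "\<dots> = (\<Sum>b\<in>B. \<Sum>i\<in>I. ip b (e i) * of_real (l i) * representation B (e i) b)"
    by (simp add: eigenbasis_apply[OF assms] representation_sum representation_scale B)
  also have "\<dots> = (\<Sum>i\<in>I. of_real (l i) * ip (\<Sum>b\<in>B. smul (representation B (e i) b) b) (e i))"
    by (subst sum.swap) (simp add: ip_sum_left ip_scale_left sum_distrib_left mult_ac)
  also have "\<dots> = (\<Sum>i\<in>I. of_real (l i))"
    using on by (simp add: sum_representation_eq[OF B(1)] B finB orthonormalD)
  finally show ?thesis by simp
qed

lemma linear_frame_operator: "Vector_Spaces.linear smul smul (frame_operator smul ip p f)"
  by unfold_locales
    (simp_all add: frame_operator_def ip_add_left ip_scale_left scale_left_distrib sum.distrib scale_sum_right)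

lemma self_adjoint_frame_operator: "ip (frame_operator smul ip p f x) y = ip x (frame_operator smul ip p f y)"
  by (simp add: frame_operator_def ip_sum_left ip_sum_right ip_scale_left ip_scale_right
        ip_commute[symmetric] mult.commute)

lemma frame_energy_eigenbasis:
  assumes on: "orthonormal I e" and fin: "finite I" and span: "span (e ` I) = UNIV"
    and eig: "\<And>i. i \<in> I \<Longrightarrow> frame_operator smul ip p f (e i) = smul (of_real (l i)) (e i)"
  shows "(\<Sum>i=1..p. (norm (ip x (f i)))\<^sup>2) = (\<Sum>j\<in>I. l j * (norm (ip x (e j)))\<^sup>2)"
proof -
  have abs: "ip x y * ip y x = of_real ((norm (ip x y))\<^sup>2)" for y
    by (subst ip_commute[of y x]) (rule mult_scnj)
  have "of_real (\<Sum>i=1..p. (norm (ip x (f i)))\<^sup>2) = ip (frame_operator smul ip p f x) x"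
    by (simp add: frame_operator_def ip_sum_left ip_scale_left abs)
  also have "\<dots> = (\<Sum>j\<in>I. of_real (l j) * (ip x (e j) * ip (e j) x))"
    by (subst eigenbasis_apply[OF linear_frame_operator on fin span eig])
       (auto simp: ip_sum_left ip_scale_left mult_ac)
  also have "\<dots> = of_real (\<Sum>j\<in>I. l j * (norm (ip x (e j)))\<^sup>2)"
    by (simp add: abs)
  finally show ?thesis unfolding of_real_eq_iff .
qed

section \<open>Norms are majorized by eigenvalues\<close>

text \<open>
  The hypothesis \<open>energy\<close> is the quadratic form of the statement that the frame operator of \<open>g\<close> is
  diagonal in \<open>e\<close> with entries \<open>\<mu>\<close>. Let \<open>U\<close> be an orthonormal basis of the span of the vectors
  with indices in \<open>K\<close>. Each of their squared norms is a sum over \<open>U\<close>, and after exchanging the sums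
  the part over \<open>K\<close> is bounded by the energy of all of \<open>g\<close> at \<open>u \<in> U\<close>. This leaves the sum of the
  \<open>\<mu> j\<close> with weights \<open>w j\<close>, the squared norm of the projection of \<open>e j\<close> to the span: at most \<open>1\<close>
  by Bessel, with total \<open>card U\<close> by Parseval.
\<close>

lemma sum_norms_le_sum_eigenvalues:
  fixes e :: "nat \<Rightarrow> 'v" and g :: "'i \<Rightarrow> 'v"
  assumes on: "orthonormal {..<n} e" and span: "span (e ` {..<n}) = UNIV"
    and anti: "antimono_on {..<n} \<mu>"
    and energy: "\<And>x. ((\<lambda>i. (norm (ip x (g i)))\<^sup>2) has_sum (\<Sum>j<n. \<mu> j * (norm (ip x (e j)))\<^sup>2)) J"
    and K: "finite K" "K \<subseteq> J" "card K \<le> n"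
  shows "(\<Sum>i\<in>K. (ip_norm ip (g i))\<^sup>2) \<le> (\<Sum>j<card K. \<mu> j)"
proof -
  obtain U where U: "finite U" "card U \<le> card (g ` K)" "orthonormal U (\<lambda>u. u)" "span U = span (g ` K)"
    using gram_schmidt[of "g ` K"] K by auto
  have card_U: "card U \<le> card K" using U(2) card_image_le[OF K(1), of g] by simp
  define w where "w j = (\<Sum>u\<in>U. (norm (ip u (e j)))\<^sup>2)" for j
  have norm_e: "(ip_norm ip (e j))\<^sup>2 = 1" if "j < n" for j
    using orthonormalD[OF on, of j j] that by (simp add: ip_norm_sq)
  have norm_u: "(ip_norm ip u)\<^sup>2 = 1" if "u \<in> U" for u
    using orthonormalD[OF U(3), of u u] that by (simp add: ip_norm_sq)
  have \<mu>: "\<mu> j \<ge> 0" if "j < n" for j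
  proof -
    have "(\<Sum>i<n. \<mu> i * (norm (ip (e j) (e i)))\<^sup>2) = (\<Sum>i<n. if i = j then \<mu> i else 0)"
      using that by (intro sum.cong) (auto simp: orthonormalD[OF on])
    also have "\<dots> = \<mu> j" using that by simp
    finally show ?thesis using has_sum_nonneg[OF energy[of "e j"]] by simp
  qed
  have w: "0 \<le> w j \<and> w j \<le> 1" if "j < n" for j
    using bessel_inequality[OF U(3,1), of "e j"] norm_e[OF that]
    by (simp add: w_def sum_nonneg norm_ip_commute[of "e j"])
  have "(\<Sum>j<n. w j) = (\<Sum>u\<in>U. \<Sum>j<n. (norm (ip u (e j)))\<^sup>2)"
    unfolding w_def by (rule sum.swap)
  also have "\<dots> = (\<Sum>u\<in>U. (ip_norm ip u)\<^sup>2)"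
    by (intro sum.cong refl parseval[symmetric] on) (auto simp: span)
  finally have sum_w: "(\<Sum>j<n. w j) \<le> real (card K)" using norm_u card_U by simp
  have "(\<Sum>i\<in>K. (ip_norm ip (g i))\<^sup>2) = (\<Sum>i\<in>K. \<Sum>u\<in>U. (norm (ip (g i) u))\<^sup>2)"
    using U by (intro sum.cong refl parseval) (auto intro: span_base)
  also have "\<dots> = (\<Sum>u\<in>U. \<Sum>i\<in>K. (norm (ip u (g i)))\<^sup>2)"
    by (subst sum.swap) (simp add: norm_ip_commute)
  also have "\<dots> \<le> (\<Sum>u\<in>U. \<Sum>j<n. \<mu> j * (norm (ip u (e j)))\<^sup>2)"
    using K by (intro sum_mono finite_sum_le_has_sum[OF energy]) auto
  also have "\<dots> = (\<Sum>j<n. \<mu> j * w j)"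
    unfolding w_def by (subst sum.swap) (simp add: sum_distrib_left)
  also have "\<dots> \<le> (\<Sum>j<card K. \<mu> j)"
    using anti \<mu> w sum_w K(3) by (rule sum_mult_le_sum_top)
  finally show ?thesis .
qed

section \<open>Prescribing norms one vector at a time\<close>

text \<open>
  \<open>g\<close> and \<open>h\<close> are the images of \<open>v\<close> and \<open>w\<close> under a rotation with angle \<open>\<theta>\<close>. Then
  the squared norm of \<open>g\<close> is \<open>cos\<^sup>2 \<theta>\<close> times that of \<open>v\<close> plus \<open>sin\<^sup>2 \<theta>\<close> times that of \<open>w\<close>, and it
  runs through all values between these two. The pair \<open>g\<close>, \<open>h\<close> need not be orthogonal; only \<open>h\<close>
  is kept in the construction, so what matters is that it is orthogonal to whatever \<open>v\<close> and \<open>w\<close> are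
  orthogonal to.
\<close>

lemma split_orthogonal_pair:
  assumes orth: "ip v w = 0" and s: "(ip_norm ip w)\<^sup>2 \<le> s" "s \<le> (ip_norm ip v)\<^sup>2"
  obtains g h where "(ip_norm ip g)\<^sup>2 = s" "(ip_norm ip h)\<^sup>2 = (ip_norm ip v)\<^sup>2 + (ip_norm ip w)\<^sup>2 - s"
    "\<And>x. (norm (ip x g))\<^sup>2 + (norm (ip x h))\<^sup>2 = (norm (ip x v))\<^sup>2 + (norm (ip x w))\<^sup>2"
    "\<And>x. ip x v = 0 \<Longrightarrow> ip x w = 0 \<Longrightarrow> ip x h = 0"
proof -
  define V W where "V = (ip_norm ip v)\<^sup>2" and "W = (ip_norm ip w)\<^sup>2"
  \<comment> \<open>\<open>t\<close> is \<open>cos\<^sup>2 \<theta>\<close>. If \<open>V = W\<close>, every rotation works, and division by zero selects \<open>t = 0\<close>.\<close>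
  define t where "t = (s - W) / (V - W)"
  have t: "0 \<le> t" "t \<le> 1" "t * V + (1 - t) * W = s"
  proof -
    have "W \<le> s" "s \<le> V" using s by (simp_all add: V_def W_def)
    then show "0 \<le> t" "t \<le> 1" "t * V + (1 - t) * W = s"
      by (cases "V = W"; simp add: t_def divide_simps; simp add: algebra_simps)+
  qed
  define c d where "c = sqrt t" and "d = sqrt (1 - t)"
  have cd: "c\<^sup>2 = t" "d\<^sup>2 = 1 - t" using t by (simp_all add: c_def d_def)
  have norm_comb: "(ip_norm ip (smul (of_real b) v + smul (of_real b') w))\<^sup>2 = b\<^sup>2 * V + b'\<^sup>2 * W" for b b'
  proof -
    have "ip w v = 0" using orth by (simp add: ip_eq_0_commute)
    then have "ip (smul (of_real b) v + smul (of_real b') w) (smul (of_real b) v + smul (of_real b') w)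
        = of_real (b\<^sup>2 * V + b'\<^sup>2 * W)"
      using orth ip_self[of v] ip_self[of w]
      by (simp add: ip_add_left ip_add_right ip_scale_left ip_scale_right V_def W_def power2_eq_square mult_ac)
    then show ?thesis by (metis ip_self of_real_eq_iff)
  qed
  define g h where "g = smul (of_real c) v + smul (of_real d) w"
    and "h = smul (of_real (- d)) v + smul (of_real c) w"
  show thesis
  proof (rule that[of g h])
    show "(ip_norm ip g)\<^sup>2 = s" using t by (simp add: g_def norm_comb cd)
    show "(ip_norm ip h)\<^sup>2 = (ip_norm ip v)\<^sup>2 + (ip_norm ip w)\<^sup>2 - s"
      unfolding h_def norm_comb V_def[symmetric] W_def[symmetric] using t by (simp add: cd algebra_simps)
    fix x
    show "ip x v = 0 \<Longrightarrow> ip x w = 0 \<Longrightarrow> ip x h = 0"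
      unfolding h_def by (simp only: ip_add_right ip_scale_right) simp
    define A B where "A = ip x v" and "B = ip x w"
    have g: "ip x g = of_real c * A + of_real d * B" and h: "ip x h = of_real (- d) * A + of_real c * B"
      unfolding g_def h_def A_def B_def ip_add_right ip_scale_right scnj_of_real by simp_all
    have "ip x g * scnj (ip x g) + ip x h * scnj (ip x h)
        = of_real (c\<^sup>2 + d\<^sup>2) * (A * scnj A + B * scnj B)"
      unfolding g h scnj_add scnj_mult scnj_of_real by (simp add: algebra_simps power2_eq_square)
    also have "c\<^sup>2 + d\<^sup>2 = 1" by (simp add: cd)
    finally have "(of_real ((norm (ip x g))\<^sup>2 + (norm (ip x h))\<^sup>2) :: 'k) = of_real ((norm A)\<^sup>2 + (norm B)\<^sup>2)"
      by (simp only: mult_scnj) simp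
    then show "(norm (ip x g))\<^sup>2 + (norm (ip x h))\<^sup>2 = (norm (ip x v))\<^sup>2 + (norm (ip x w))\<^sup>2"
      unfolding of_real_eq_iff A_def B_def .
  qed
qed

text \<open>
  The invariant of the construction: an orthogonal family \<open>v 0, \<dots>, v (n - 1)\<close>, continued by zeros,
  whose squared norms are sorted and weakly majorize \<open>a\<close>. For \<open>k \<ge> n\<close> the last condition bounds all
  partial sums of \<open>a\<close> by the total mass of \<open>v\<close>.
\<close>

definition orthogonal_majorant :: "nat \<Rightarrow> (nat \<Rightarrow> real) \<Rightarrow> (nat \<Rightarrow> 'v) \<Rightarrow> bool" where
  "orthogonal_majorant n a v \<longleftrightarrow>
     (\<forall>i j. i \<noteq> j \<longrightarrow> ip (v i) (v j) = 0) \<and> (\<forall>i\<ge>n. v i = 0) \<and>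
     antimono (\<lambda>i. (ip_norm ip (v i))\<^sup>2) \<and>
     (\<forall>k. (\<Sum>i<k. a i) \<le> (\<Sum>i<k. (ip_norm ip (v i))\<^sup>2))"

text \<open>
  Let \<open>j\<close> be the last index at which the squared norm \<open>\<mu> j\<close> is at least \<open>a 0\<close>. Then \<open>a 0\<close> lies
  between \<open>\<mu> j\<close> and \<open>\<mu> (j + 1)\<close>, and splitting this pair yields \<open>g\<close> with squared norm \<open>a 0\<close> and
  a remainder \<open>h\<close> whose squared norm \<open>\<mu> j + \<mu> (j + 1) - a 0\<close> again lies between the two, so that
  the new family is still sorted. For \<open>j = n - 1\<close> the partner \<open>v n = 0\<close> comes from the continuation
  by zeros. The new family majorizes the rest of \<open>a\<close>: the first \<open>k \<le> j\<close> members are unchanged and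
  each has squared norm at least \<open>a 0\<close>, and for \<open>k > j\<close> both sides of the old inequality for
  \<open>k + 1\<close> have lost \<open>a 0\<close>.
\<close>

lemma peel_off_vector:
  assumes maj: "orthogonal_majorant n a v" and n: "n \<ge> 1" and anti: "antimono a" and nonneg: "a 0 \<ge> 0"
  obtains g v' where "(ip_norm ip g)\<^sup>2 = a 0" "orthogonal_majorant n (\<lambda>i. a (Suc i)) v'"
    "\<And>x. (\<Sum>i<n. (norm (ip x (v' i)))\<^sup>2) + (norm (ip x g))\<^sup>2 = (\<Sum>i<n. (norm (ip x (v i)))\<^sup>2)"
    "(\<Sum>i<n. (ip_norm ip (v' i))\<^sup>2) + a 0 = (\<Sum>i<n. (ip_norm ip (v i))\<^sup>2)"
proof -
  define \<mu> where "\<mu> i = (ip_norm ip (v i))\<^sup>2" for i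
  have orth: "\<And>i j. i \<noteq> j \<Longrightarrow> ip (v i) (v j) = 0" and zero: "\<And>i. i \<ge> n \<Longrightarrow> v i = 0"
    and anti_\<mu>: "antimono \<mu>" and sums: "\<And>k. (\<Sum>i<k. a i) \<le> (\<Sum>i<k. \<mu> i)"
    using maj unfolding orthogonal_majorant_def \<mu>_def[abs_def] by blast+
  have \<mu>0: "\<mu> i = 0" if "i \<ge> n" for i using zero[OF that] by (simp add: \<mu>_def ip_norm_def)
  define S where "S = {j. j < n \<and> a 0 \<le> \<mu> j}"
  define j where "j = Max S"
  have S: "finite S" "0 \<in> S" using n sums[of 1] by (auto simp: S_def)
  then have "j \<in> S" unfolding j_def by (intro Max_in) auto
  then have j: "j < n" "a 0 \<le> \<mu> j" by (auto simp: S_def)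
  have above: "a 0 \<le> \<mu> i" if "i \<le> j" for i using j anti_\<mu> that by (metis antimonoD order_trans)
  have below: "\<mu> (Suc j) \<le> a 0"
  proof (cases "Suc j < n")
    case True
    then show ?thesis using Max_ge[OF S(1), of "Suc j"] unfolding j_def[symmetric] by (force simp: S_def)
  next
    case False
    then show ?thesis using \<mu>0 nonneg by simp
  qed
  obtain g h where g: "(ip_norm ip g)\<^sup>2 = a 0" and h: "(ip_norm ip h)\<^sup>2 = \<mu> j + \<mu> (Suc j) - a 0"
    and gh: "\<And>x. (norm (ip x g))\<^sup>2 + (norm (ip x h))\<^sup>2 = (norm (ip x (v j)))\<^sup>2 + (norm (ip x (v (Suc j))))\<^sup>2"
    and h_orth: "\<And>x. ip x (v j) = 0 \<Longrightarrow> ip x (v (Suc j)) = 0 \<Longrightarrow> ip x h = 0"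
    using split_orthogonal_pair[of "v j" "v (Suc j)" "a 0"] orth[of j "Suc j"] below j(2)
    unfolding \<mu>_def by (metis n_not_Suc_n)
  define v' where "v' i = (if i < j then v i else if i = j then h else v (Suc i))" for i
  define \<mu>' where "\<mu>' i = (ip_norm ip (v' i))\<^sup>2" for i
  have \<mu>': "\<mu>' i = (if i < j then \<mu> i else if i = j then \<mu> j + \<mu> (Suc j) - a 0 else \<mu> (Suc i))" for i
    by (simp add: \<mu>'_def v'_def \<mu>_def h)
  have merged: "(\<Sum>i<k. \<mu>' i) + a 0 = (\<Sum>i<Suc k. \<mu> i)" if "j < k" for k
    by (rule sum_merge_adjacent[OF _ _ _ that]) (auto simp: \<mu>')
  have "orthogonal_majorant n (\<lambda>i. a (Suc i)) v'"
    unfolding orthogonal_majorant_def \<mu>'_def[symmetric]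
  proof (intro conjI allI impI)
    fix i k :: nat assume "i \<noteq> k"
    have hv: "ip (v i) h = 0 \<and> ip h (v i) = 0" if "i \<noteq> j" "i \<noteq> Suc j" for i
      using h_orth[of "v i"] orth that ip_eq_0_commute by metis
    then show "ip (v' i) (v' k) = 0" using \<open>i \<noteq> k\<close> orth by (simp add: v'_def)
  next
    fix i assume "i \<ge> n"
    then show "v' i = 0" using j zero by (simp add: v'_def)
  next
    have mono: "\<mu> (Suc i) \<le> \<mu> i" for i using anti_\<mu> by (simp add: antimonoD)
    have "\<mu>' (Suc i) \<le> \<mu>' i" for i
    proof -
      consider "Suc i < j" | "Suc i = j" | "i = j" | "i > j" by linarith
      then show ?thesis
      proof cases
        case 2 then show ?thesis using mono[of i] below by (simp add: \<mu>')
      next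
        case 3 then show ?thesis using mono[of "Suc j"] j by (simp add: \<mu>')
      qed (simp_all add: \<mu>' mono)
    qed
    then show "antimono \<mu>'" by (simp add: decseq_Suc_iff)
  next
    fix k
    show "(\<Sum>i<k. a (Suc i)) \<le> (\<Sum>i<k. \<mu>' i)"
    proof (cases "j < k")
      case True
      then show ?thesis using merged[OF True] sums[of "Suc k"] by (simp add: sum.lessThan_Suc_shift del: sum.lessThan_Suc)
    next
      case False
      have "a (Suc i) \<le> \<mu>' i" if "i < k" for i
        using above[of i] antimonoD[OF anti, of 0 "Suc i"] that False by (simp add: \<mu>')
      then show ?thesis by (intro sum_mono) auto
    qed
  qed
  moreover have "(\<Sum>i<n. (norm (ip x (v' i)))\<^sup>2) + (norm (ip x g))\<^sup>2 = (\<Sum>i<n. (norm (ip x (v i)))\<^sup>2)" for x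
  proof -
    have "(\<Sum>i<n. (norm (ip x (v' i)))\<^sup>2) + (norm (ip x g))\<^sup>2 = (\<Sum>i<Suc n. (norm (ip x (v i)))\<^sup>2)"
      by (rule sum_merge_adjacent[OF _ _ _ j(1)]) (use gh[of x] in \<open>auto simp: v'_def\<close>)
    then show ?thesis by (simp add: zero)
  qed
  moreover have "(\<Sum>i<n. \<mu>' i) + a 0 = (\<Sum>i<n. \<mu> i)"
    using merged[OF j(1)] by (simp add: \<mu>0)
  ultimately show thesis using that[of g v'] g by (simp add: \<mu>_def \<mu>'_def)
qed

text \<open>
  \<open>V m\<close> is the orthogonal family left after peeling off \<open>m\<close> vectors. Its mass is the tail of the
  series of \<open>a\<close>, and by Cauchy-Schwarz its energy at \<open>x\<close> is at most this mass times the squared norm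
  of \<open>x\<close>. So the energy not yet accounted for by the peeled vectors tends to \<open>0\<close>.
\<close>

lemma orthogonal_majorant_realization:
  assumes maj: "orthogonal_majorant n a v" and n: "n \<ge> 1" and anti: "antimono a" and nonneg: "\<And>i. a i \<ge> 0"
    and sums: "a sums (\<Sum>i<n. (ip_norm ip (v i))\<^sup>2)"
  obtains g where "\<And>i. (ip_norm ip (g i))\<^sup>2 = a i"
    "\<And>x. (\<lambda>i. (norm (ip x (g i)))\<^sup>2) sums (\<Sum>i<n. (norm (ip x (v i)))\<^sup>2)"
proof -
  define R where "R m g u u' \<longleftrightarrow> (ip_norm ip g)\<^sup>2 = a m \<and>
    (\<forall>x. (\<Sum>i<n. (norm (ip x (u' i)))\<^sup>2) + (norm (ip x g))\<^sup>2 = (\<Sum>i<n. (norm (ip x (u i)))\<^sup>2)) \<and>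
    (\<Sum>i<n. (ip_norm ip (u' i))\<^sup>2) + a m = (\<Sum>i<n. (ip_norm ip (u i))\<^sup>2)" for m g u u'
  have "\<exists>V. \<forall>m. (orthogonal_majorant n (\<lambda>i. a (m + i)) (V m) \<and> (m = 0 \<longrightarrow> V m = v)) \<and>
      (\<exists>g. R m g (V m) (V (Suc m)))"
  proof (rule dependent_nat_choice)
    show "\<exists>u. orthogonal_majorant n (\<lambda>i. a (0 + i)) u \<and> (0 = 0 \<longrightarrow> u = v)" using maj by simp
  next
    fix u m assume u: "orthogonal_majorant n (\<lambda>i. a (m + i)) u \<and> (m = 0 \<longrightarrow> u = v)"
    have "antimono (\<lambda>i. a (m + i))" using anti by (auto simp: antimono_def)
    obtain g u' where "orthogonal_majorant n (\<lambda>i. a (m + Suc i)) u'" "R m g u u'"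
      by (rule peel_off_vector[OF conjunct1[OF u] n \<open>antimono (\<lambda>i. a (m + i))\<close> nonneg])
         (auto simp: R_def)
    then show "\<exists>u'. (orthogonal_majorant n (\<lambda>i. a (Suc m + i)) u' \<and> (Suc m = 0 \<longrightarrow> u' = v)) \<and> (\<exists>g. R m g u u')"
      by auto
  qed
  then obtain V g where V0: "V 0 = v" and R: "\<And>m. R m (g m) (V m) (V (Suc m))"
    by metis
  have energy: "(\<Sum>i<m. (norm (ip x (g i)))\<^sup>2) + (\<Sum>i<n. (norm (ip x (V m i)))\<^sup>2) = (\<Sum>i<n. (norm (ip x (v i)))\<^sup>2)" for x m
  proof (induction m)
    case (Suc m)
    have "(\<Sum>i<n. (norm (ip x (V (Suc m) i)))\<^sup>2) + (norm (ip x (g m)))\<^sup>2 = (\<Sum>i<n. (norm (ip x (V m i)))\<^sup>2)"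
      using R[of m] by (simp add: R_def)
    then show ?case using Suc by simp
  qed (simp add: V0)
  have mass: "(\<Sum>i<m. a i) + (\<Sum>i<n. (ip_norm ip (V m i))\<^sup>2) = (\<Sum>i<n. (ip_norm ip (v i))\<^sup>2)" for m
  proof (induction m)
    case (Suc m)
    then show ?case using R[of m] unfolding R_def by simp
  qed (simp add: V0)
  show thesis
  proof (rule that[of g])
    show "(ip_norm ip (g i))\<^sup>2 = a i" for i using R[of i] by (simp add: R_def)
    fix x
    let ?A = "\<Sum>i<n. (ip_norm ip (v i))\<^sup>2" and ?S = "\<Sum>i<n. (norm (ip x (v i)))\<^sup>2"
    have lower: "?S - (ip_norm ip x)\<^sup>2 * (?A - (\<Sum>i<m. a i)) \<le> (\<Sum>i<m. (norm (ip x (g i)))\<^sup>2)" for m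
    proof -
      have "(\<Sum>i<n. (norm (ip x (V m i)))\<^sup>2) \<le> (ip_norm ip x)\<^sup>2 * (\<Sum>i<n. (ip_norm ip (V m i))\<^sup>2)"
        unfolding sum_distrib_left by (intro sum_mono cauchy_schwarz)
      also have "(\<Sum>i<n. (ip_norm ip (V m i))\<^sup>2) = ?A - (\<Sum>i<m. a i)" using mass[of m] by simp
      finally show ?thesis using energy[of x m] by simp
    qed
    have upper: "(\<Sum>i<m. (norm (ip x (g i)))\<^sup>2) \<le> ?S" for m
      using energy[of x m] sum_nonneg[of "{..<n}" "\<lambda>i. (norm (ip x (V m i)))\<^sup>2"] by simp
    have "(\<lambda>m. ?S - (ip_norm ip x)\<^sup>2 * (?A - (\<Sum>i<m. a i))) \<longlonglongrightarrow> ?S - (ip_norm ip x)\<^sup>2 * (?A - ?A)"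
      using sums unfolding sums_def by (intro tendsto_intros)
    then have "(\<lambda>m. ?S - (ip_norm ip x)\<^sup>2 * (?A - (\<Sum>i<m. a i))) \<longlonglongrightarrow> ?S" by simp
    then show "(\<lambda>i. (norm (ip x (g i)))\<^sup>2) sums ?S"
      unfolding sums_def by (rule tendsto_sandwich[OF _ _ _ tendsto_const, rotated 2]) (use lower upper in auto)
  qed
qed

end


section \<open>Tight completions\<close>

lemma seq_idx_enat: "seq_idx (enat r) = {1..r}" and seq_idx_infinity: "seq_idx \<infinity> = {1..}"
  by (auto simp: seq_idx_def)

lemma seq_idx_eq_image: "seq_idx m = Suc ` {i. enat (Suc i) \<le> m}"
proof -
  have "\<exists>j. i = Suc j \<and> enat (Suc j) \<le> m" if "1 \<le> i" "enat i \<le> m" for i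
    using that by (cases i) auto
  then show ?thesis by (auto simp: seq_idx_def)
qed

lemma has_sum_finite_sum:
  fixes h :: "'j \<Rightarrow> 'i \<Rightarrow> 'a::topological_comm_monoid_add"
  assumes "\<And>j. j \<in> I \<Longrightarrow> (h j has_sum s j) A"
  shows "((\<lambda>i. \<Sum>j\<in>I. h j i) has_sum (\<Sum>j\<in>I. s j)) A"
  using assms by (induction I rule: infinite_finite_induct) (auto intro: has_sum_add)

lemma has_sum_seq_concat:
  fixes F :: "'v \<Rightarrow> real"
  shows "((\<lambda>i. F (seq_concat p f g i)) has_sum s) (seq_idx (enat p + m)) \<longleftrightarrow>
    ((\<lambda>i. F (g i)) has_sum (s - (\<Sum>i=1..p. F (f i)))) (seq_idx m)"
proof -
  let ?F = "\<lambda>i. F (seq_concat p f g i)" and ?B = "(\<lambda>i. i + p) ` seq_idx m"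
  have idx: "seq_idx (enat p + m) = {1..p} \<union> ?B"
  proof (rule set_eqI)
    fix i
    have "i \<in> ?B \<longleftrightarrow> i > p \<and> i - p \<in> seq_idx m"
      by (auto simp: image_iff seq_idx_def intro!: bexI[of _ "i - p"])
    then show "i \<in> seq_idx (enat p + m) \<longleftrightarrow> i \<in> {1..p} \<union> ?B"
      by (cases m) (auto simp: seq_idx_enat seq_idx_infinity)
  qed
  have disj: "{1..p} \<inter> ?B = {}" by (auto simp: seq_idx_def)
  have head: "(?F has_sum (\<Sum>i=1..p. F (f i))) {1..p}"
    by (rule has_sum_finiteI) (auto simp: seq_concat_def intro!: sum.cong)
  have "(?F has_sum t) ?B \<longleftrightarrow> ((?F \<circ> (\<lambda>i. i + p)) has_sum t) (seq_idx m)" for t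
    by (rule has_sum_reindex) (simp add: inj_on_def)
  also have "((?F \<circ> (\<lambda>i. i + p)) has_sum t) (seq_idx m) \<longleftrightarrow> ((\<lambda>i. F (g i)) has_sum t) (seq_idx m)" for t
    by (rule has_sum_cong) (auto simp: seq_concat_def seq_idx_def)
  finally have tail: "(?F has_sum t) ?B \<longleftrightarrow> ((\<lambda>i. F (g i)) has_sum t) (seq_idx m)" for t .
  have "(?F has_sum s) ({1..p} \<union> ?B) \<longleftrightarrow> (?F has_sum (s - (\<Sum>i=1..p. F (f i)))) ?B"
  proof
    assume "(?F has_sum s) ({1..p} \<union> ?B)"
    then have "(?F has_sum (s - (\<Sum>i=1..p. F (f i)))) ({1..p} \<union> ?B - {1..p})"
      using head by (rule has_sum_Diff) auto
    moreover have "{1..p} \<union> ?B - {1..p} = ?B" using disj by blast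
    ultimately show "(?F has_sum (s - (\<Sum>i=1..p. F (f i)))) ?B" by simp
  next
    assume "(?F has_sum (s - (\<Sum>i=1..p. F (f i)))) ?B"
    from has_sum_Un_disjoint[OF head this disj] show "(?F has_sum s) ({1..p} \<union> ?B)" by simp
  qed
  then show ?thesis unfolding idx tail .
qed

context inner_product_space
begin

lemma tight_frame_concat_iff:
  fixes e :: "nat \<Rightarrow> 'v"
  assumes on: "orthonormal {..<n} e" and span: "span (e ` {..<n}) = UNIV"
    and eig: "\<And>j. j < n \<Longrightarrow> frame_operator smul ip p f (e j) = smul (of_real (\<nu> j)) (e j)"
  shows "tight_frame ip (enat p + m) (seq_concat p f g) \<longleftrightarrow>
    (\<exists>c>0. \<forall>x. ((\<lambda>i. (norm (ip x (g i)))\<^sup>2) has_sum (\<Sum>j<n. (c - \<nu> j) * (norm (ip x (e j)))\<^sup>2)) (seq_idx m))"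
proof -
  have "c * (ip_norm ip x)\<^sup>2 - (\<Sum>i=1..p. (norm (ip x (f i)))\<^sup>2) = (\<Sum>j<n. (c - \<nu> j) * (norm (ip x (e j)))\<^sup>2)" for c x
    using frame_energy_eigenbasis[OF on _ span, of p f \<nu> x] eig parseval[OF on, of x] span
    by (simp add: left_diff_distrib sum_subtractf sum_distrib_left)
  then show ?thesis
    unfolding tight_frame_def using has_sum_seq_concat[where F = "\<lambda>y. (norm (ip _ y))\<^sup>2"] by simp
qed

text \<open>
  From here on \<open>\<nu>\<close> is the increasing list of the eigenvalues of the frame operator of \<open>f\<close>, indexed
  from \<open>0\<close>, so that \<open>c - \<nu> j\<close> is decreasing. The first claim sums the energies of all the \<open>e j\<close>
  and thereby identifies \<open>c\<close>; the second is the positivity of the energy of the last one.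
\<close>

lemma tight_completion_necessary:
  fixes e :: "nat \<Rightarrow> 'v"
  assumes on: "orthonormal {..<n} e" and span: "span (e ` {..<n}) = UNIV" and n: "n \<ge> 1"
    and mono: "mono_on {..<n} \<nu>"
    and energy: "\<And>x. ((\<lambda>i. (norm (ip x (g i)))\<^sup>2) has_sum (\<Sum>j<n. (c - \<nu> j) * (norm (ip x (e j)))\<^sup>2)) (seq_idx m)"
    and norms: "\<And>i. i \<in> seq_idx m \<Longrightarrow> (ip_norm ip (g i))\<^sup>2 = a i"
  shows "(a has_sum (real n * c - (\<Sum>j<n. \<nu> j))) (seq_idx m)"
    and "\<nu> (n - 1) \<le> c"
    and "k \<le> n \<Longrightarrow> enat k \<le> m \<Longrightarrow> (\<Sum>i=1..k. a i) \<le> (\<Sum>j<k. c - \<nu> j)"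
proof -
  have energy_e: "((\<lambda>i. (norm (ip (e j) (g i)))\<^sup>2) has_sum (c - \<nu> j)) (seq_idx m)" if "j < n" for j
  proof -
    have "(\<Sum>i<n. (c - \<nu> i) * (norm (ip (e j) (e i)))\<^sup>2) = (\<Sum>i<n. if i = j then c - \<nu> i else 0)"
      using that by (intro sum.cong) (auto simp: orthonormalD[OF on])
    also have "\<dots> = c - \<nu> j" using that by simp
    finally show ?thesis using energy[of "e j"] by simp
  qed
  have "((\<lambda>i. \<Sum>j<n. (norm (ip (e j) (g i)))\<^sup>2) has_sum (\<Sum>j<n. c - \<nu> j)) (seq_idx m)"
    using energy_e by (intro has_sum_finite_sum) auto
  also have "?this \<longleftrightarrow> (a has_sum (\<Sum>j<n. c - \<nu> j)) (seq_idx m)"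
    by (rule has_sum_cong)
       (simp add: norms[symmetric] parseval[OF on] span norm_ip_commute[of "g _"])
  finally show "(a has_sum (real n * c - (\<Sum>j<n. \<nu> j))) (seq_idx m)" by (simp add: sum_subtractf)
  show "\<nu> (n - 1) \<le> c"
    using has_sum_nonneg[OF energy_e[of "n - 1"]] n by simp
  assume k: "k \<le> n" "enat k \<le> m"
  have "{1..k} \<subseteq> seq_idx m" using k(2) by (auto simp: seq_idx_def intro: order_trans[rotated])
  moreover have "antimono_on {..<n} (\<lambda>j. c - \<nu> j)"
    using mono by (auto simp: monotone_on_def)
  ultimately have "(\<Sum>i=1..k. (ip_norm ip (g i))\<^sup>2) \<le> (\<Sum>j<k. c - \<nu> j)"
    using sum_norms_le_sum_eigenvalues[OF on span _ energy, of "{1..k}"] k by simp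
  moreover have "(\<Sum>i=1..k. (ip_norm ip (g i))\<^sup>2) = (\<Sum>i=1..k. a i)"
    using \<open>{1..k} \<subseteq> seq_idx m\<close> norms by (intro sum.cong) auto
  ultimately show "(\<Sum>i=1..k. a i) \<le> (\<Sum>j<k. c - \<nu> j)" by simp
qed

text \<open>
  The construction starts from the orthogonal vectors with squared norms \<open>\<mu> j\<close> in the directions
  \<open>e j\<close>. The sequence \<open>b\<close> is \<open>a\<close>, indexed from \<open>0\<close>, and for finite \<open>m\<close> padded by zeros; the
  vectors constructed for the padding vanish and can be dropped.
\<close>

lemma tight_completion_sufficient:
  fixes e :: "nat \<Rightarrow> 'v"
  assumes on: "orthonormal {..<n} e" and n: "n \<ge> 1"
    and anti: "antimono_on {..<n} \<mu>" and nonneg: "\<And>j. j < n \<Longrightarrow> \<mu> j \<ge> 0"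
    and a: "antimono_on {1..} a" "\<And>i. i \<ge> 1 \<Longrightarrow> a i \<ge> 0"
    and total: "(a has_sum (\<Sum>j<n. \<mu> j)) (seq_idx m)"
    and maj: "\<And>k. k \<le> n \<Longrightarrow> enat k \<le> m \<Longrightarrow> (\<Sum>i=1..k. a i) \<le> (\<Sum>j<k. \<mu> j)"
  obtains g where "\<And>i. i \<in> seq_idx m \<Longrightarrow> (ip_norm ip (g i))\<^sup>2 = a i"
    "\<And>x. ((\<lambda>i. (norm (ip x (g i)))\<^sup>2) has_sum (\<Sum>j<n. \<mu> j * (norm (ip x (e j)))\<^sup>2)) (seq_idx m)"
proof -
  define J where "J = {i. enat (Suc i) \<le> m}"
  define b where "b i = (if i \<in> J then a (Suc i) else 0)" for i
  define v where "v i = (if i < n then smul (of_real (sqrt (\<mu> i))) (e i) else 0)" for i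
  have reindex: "(h has_sum s) (seq_idx m) \<longleftrightarrow> ((\<lambda>i. h (Suc i)) has_sum s) J" for h :: "nat \<Rightarrow> real" and s
    unfolding seq_idx_eq_image J_def[symmetric] by (subst has_sum_reindex) (simp_all add: o_def)
  have norm_v: "(ip_norm ip (v i))\<^sup>2 = (if i < n then \<mu> i else 0)" for i
    using orthonormalD[OF on, of i i] nonneg[of i]
    by (simp add: v_def ip_norm_scale_sq) (simp add: ip_norm_def)
  have J_down: "i \<in> J" if "j \<in> J" "i \<le> j" for i j
    using that by (auto simp: J_def intro: order_trans[of _ "enat (Suc j)"])
  have b0: "b i \<ge> 0" for i using a(2) by (simp add: b_def)
  have anti_b: "antimono b"
    using J_down b0 monotone_onD[OF a(1)] a(2) by (auto simp: antimono_def b_def)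
  have "(b has_sum (\<Sum>j<n. \<mu> j)) UNIV"
    using total unfolding reindex by (subst has_sum_cong_neutral[of J]) (auto simp: b_def)
  then have b_total: "(b has_sum (\<Sum>i<n. (ip_norm ip (v i))\<^sup>2)) UNIV" by (simp add: norm_v)
  \<comment> \<open>Majorization is assumed for \<open>k\<close> up to \<open>n\<close> and \<open>m\<close>. Beyond \<open>n\<close> the right-hand side is the total
    mass; beyond \<open>m\<close> the left-hand side no longer grows.\<close>
  have b_sums: "(\<Sum>i<k. b i) \<le> (\<Sum>i<k. (ip_norm ip (v i))\<^sup>2)" for k
  proof -
    have good: "(\<Sum>i<k. b i) \<le> (\<Sum>i<k. (ip_norm ip (v i))\<^sup>2)" if "k \<le> n" "enat k \<le> m" for k
    proof -
      have "(\<Sum>i<k. b i) = (\<Sum>i<k. a (Suc i))"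
        using that(2) by (intro sum.cong) (auto simp: b_def J_def intro: order_trans[of _ "enat k"])
      also have "\<dots> = (\<Sum>i=1..k. a i)"
        by (rule sum.reindex_bij_witness[of _ "\<lambda>i. i - 1" Suc]) auto
      also have "\<dots> \<le> (\<Sum>i<k. \<mu> i)" by (rule maj) fact+
      also have "\<dots> = (\<Sum>i<k. (ip_norm ip (v i))\<^sup>2)" using that(1) by (simp add: norm_v)
      finally show ?thesis .
    qed
    consider "k > n" | "k \<le> n" "enat k \<le> m" | "k \<le> n" "enat k > m" by fastforce
    then show ?thesis
    proof cases
      case 1
      have "(\<Sum>i<k. b i) \<le> (\<Sum>i<n. (ip_norm ip (v i))\<^sup>2)"
        using b0 by (intro finite_sum_le_has_sum[OF b_total]) auto
      also have "\<dots> \<le> (\<Sum>i<k. (ip_norm ip (v i))\<^sup>2)"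
        using 1 by (intro sum_mono2) auto
      finally show ?thesis .
    next
      case 2
      then show ?thesis by (rule good)
    next
      case 3
      then obtain r where r: "m = enat r" "r < k" by (cases m) auto
      have "(\<Sum>i<k. b i) = (\<Sum>i<r. b i)"
        using r by (intro sum.mono_neutral_right) (auto simp: b_def J_def)
      also have "\<dots> \<le> (\<Sum>i<r. (ip_norm ip (v i))\<^sup>2)" using r 3 by (intro good) auto
      also have "\<dots> \<le> (\<Sum>i<k. (ip_norm ip (v i))\<^sup>2)" using r by (intro sum_mono2) auto
      finally show ?thesis .
    qed
  qed
  have "orthogonal_majorant n b v"
    unfolding orthogonal_majorant_def norm_v[abs_def]
  proof (intro conjI allI impI)
    show "ip (v i) (v j) = 0" if "i \<noteq> j" for i j
      using that orthonormalD[OF on] by (auto simp: v_def ip_scale_left ip_scale_right)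
    show "v i = 0" if "i \<ge> n" for i using that by (simp add: v_def)
    show "antimono (\<lambda>i. if i < n then \<mu> i else 0)"
      using nonneg monotone_onD[OF anti] by (auto simp: antimono_def)
    show "(\<Sum>i<k. b i) \<le> (\<Sum>i<k. if i < n then \<mu> i else 0)" for k
      using b_sums[of k] by (simp add: norm_v)
  qed
  then obtain g where g: "\<And>i. (ip_norm ip (g i))\<^sup>2 = b i"
      "\<And>x. (\<lambda>i. (norm (ip x (g i)))\<^sup>2) sums (\<Sum>i<n. (norm (ip x (v i)))\<^sup>2)"
    using orthogonal_majorant_realization[OF _ n anti_b b0 has_sum_imp_sums[OF b_total]] by blast
  show thesis
  proof (rule that[of "\<lambda>i. g (i - 1)"])
    fix i assume "i \<in> seq_idx m"
    then show "(ip_norm ip (g (i - 1)))\<^sup>2 = a i" using g(1)[of "i - 1"] by (auto simp: b_def seq_idx_eq_image J_def)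
  next
    fix x
    have "(\<Sum>i<n. (norm (ip x (v i)))\<^sup>2) = (\<Sum>j<n. \<mu> j * (norm (ip x (e j)))\<^sup>2)"
      using nonneg by (intro sum.cong) (auto simp: v_def ip_scale_right norm_mult power_mult_distrib)
    then have "((\<lambda>i. (norm (ip x (g i)))\<^sup>2) has_sum (\<Sum>j<n. \<mu> j * (norm (ip x (e j)))\<^sup>2)) UNIV"
      using g(2)[of x] by (intro sums_nonneg_imp_has_sum) auto
    moreover have "g i = 0" if "i \<notin> J" for i using g(1)[of i] that ip_norm_eq_0[of "g i"] by (simp add: b_def)
    ultimately have "((\<lambda>i. (norm (ip x (g i)))\<^sup>2) has_sum (\<Sum>j<n. \<mu> j * (norm (ip x (e j)))\<^sup>2)) J"
      by (subst has_sum_cong_neutral[of UNIV _ _ "\<lambda>i. (norm (ip x (g i)))\<^sup>2"]) auto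
    then show "((\<lambda>i. (norm (ip x (g (i - 1))))\<^sup>2) has_sum (\<Sum>j<n. \<mu> j * (norm (ip x (e j)))\<^sup>2)) (seq_idx m)"
      unfolding reindex by simp
  qed
qed

text \<open>
  Both parts of the theorem at once. As the constant of the tight frame must be the average \<open>C\<close>, the
  conditions say that the numbers \<open>C - \<nu> j\<close> are nonnegative and majorize \<open>a\<close>.
\<close>

lemma tight_completion_iff:
  assumes n: "n \<ge> 1" and dim: "dim (UNIV :: 'v set) = n"
    and eig: "ordered_eigenvalues smul (frame_operator smul ip p f) n l"
    and tr: "of_real \<alpha> = operator_trace smul (frame_operator smul ip p f)"
    and a: "antimono_on {1..} a" "\<forall>i\<ge>1. a i > 0" and m: "m \<ge> 1"
  shows "(\<exists>g. (\<forall>i\<in>seq_idx m. (ip_norm ip (g i))\<^sup>2 = a i) \<and> tight_frame ip (enat p + m) (seq_concat p f g)) \<longleftrightarrow>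
    a summable_on seq_idx m \<and> 1 / real n * (infsum a (seq_idx m) + \<alpha>) \<ge> l 1 \<and>
    (\<forall>k. 1 \<le> k \<and> k \<le> n \<and> enat k \<le> m \<longrightarrow>
      1 / real n * (infsum a (seq_idx m) + \<alpha>) \<ge> 1 / real k * (\<Sum>i=1..k. a i + l (n - i + 1)))"
    (is "?L \<longleftrightarrow> ?R")
proof -
  let ?T = "frame_operator smul ip p f"
  obtain e' where e': "orthonormal {1..n} e'" "span (e' ` {1..n}) = UNIV"
      "\<And>i. i \<in> {1..n} \<Longrightarrow> ?T (e' i) = smul (of_real (l i)) (e' i)"
    using eigenbasis[OF linear_frame_operator self_adjoint_frame_operator dim n eig] by blast
  define e where "e j = e' (n - j)" for j
  define \<nu> where "\<nu> j = l (n - j)" for j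
  have bij: "bij_betw (\<lambda>j. n - j) {..<n} {1..n}"
    by (rule bij_betwI[of _ _ _ "\<lambda>j. n - j"]) auto
  have on: "orthonormal {..<n} e"
    using e'(1) by (auto simp: orthonormal_def e_def)
  have "e ` {..<n} = e' ` ((\<lambda>j. n - j) ` {..<n})" by (simp add: image_image e_def)
  then have span: "span (e ` {..<n}) = UNIV" using e'(2) bij by (simp add: bij_betw_def)
  have Te: "?T (e j) = smul (of_real (\<nu> j)) (e j)" if "j < n" for j
    using that e'(3) by (simp add: e_def \<nu>_def)
  have mono: "mono_on {..<n} \<nu>"
    using eig by (auto simp: ordered_eigenvalues_def monotone_on_def \<nu>_def)
  have \<nu>_nonneg: "\<nu> j \<ge> 0" if "j < n" for j
  proof -
    have "(\<Sum>i=1..p. (norm (ip (e j) (f i)))\<^sup>2) = (\<Sum>i<n. \<nu> i * (norm (ip (e j) (e i)))\<^sup>2)"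
      by (rule frame_energy_eigenbasis[OF on _ span]) (use Te in auto)
    also have "\<dots> = (\<Sum>i<n. if i = j then \<nu> i else 0)"
      using that by (intro sum.cong) (auto simp: orthonormalD[OF on])
    also have "\<dots> = \<nu> j" using that by simp
    finally show ?thesis by (metis sum_nonneg zero_le_power2)
  qed
  have "of_real \<alpha> = (of_real (\<Sum>j<n. \<nu> j) :: 'k)"
    unfolding tr by (rule operator_trace_eigenbasis[OF linear_frame_operator on _ span]) (use Te in auto)
  then have \<alpha>: "\<alpha> = (\<Sum>j<n. \<nu> j)" unfolding of_real_eq_iff .
  define C where "C = 1 / real n * (infsum a (seq_idx m) + \<alpha>)"
  have nC: "real n * C = infsum a (seq_idx m) + \<alpha>" using n by (simp add: C_def)
  have avg: "1 / real k * (\<Sum>i=1..k. a i + l (n - i + 1)) \<le> C \<longleftrightarrow> (\<Sum>i=1..k. a i) \<le> (\<Sum>j<k. C - \<nu> j)"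
    if "1 \<le> k" "k \<le> n" for k
  proof -
    have "(\<Sum>i=1..k. l (n - i + 1)) = (\<Sum>j<k. \<nu> j)"
      using that by (intro sum.reindex_bij_witness[of _ Suc "\<lambda>i. i - 1"]) (auto simp: \<nu>_def Suc_diff_le)
    then show ?thesis using that by (simp add: sum.distrib sum_subtractf field_simps)
  qed
  have "?R \<longleftrightarrow> a summable_on seq_idx m \<and> \<nu> (n - 1) \<le> C \<and>
      (\<forall>k. 1 \<le> k \<and> k \<le> n \<and> enat k \<le> m \<longrightarrow> (\<Sum>i=1..k. a i) \<le> (\<Sum>j<k. C - \<nu> j))"
    unfolding C_def[symmetric] using avg n by (auto simp: \<nu>_def)
  also have "\<dots> \<longleftrightarrow> ?L"
  proof safe
    fix g assume "\<forall>i\<in>seq_idx m. (ip_norm ip (g i))\<^sup>2 = a i" "tight_frame ip (enat p + m) (seq_concat p f g)"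
    then obtain c where norms: "\<And>i. i \<in> seq_idx m \<Longrightarrow> (ip_norm ip (g i))\<^sup>2 = a i"
      and energy: "\<And>x. ((\<lambda>i. (norm (ip x (g i)))\<^sup>2) has_sum (\<Sum>j<n. (c - \<nu> j) * (norm (ip x (e j)))\<^sup>2)) (seq_idx m)"
      using tight_frame_concat_iff[OF on span Te] by auto
    note nec = tight_completion_necessary[OF on span n mono energy norms]
    have "C = c" using nC infsumI[OF nec(1)] n by (simp add: \<alpha>)
    then show "a summable_on seq_idx m" "\<nu> (n - 1) \<le> C"
      "\<And>k. 1 \<le> k \<Longrightarrow> k \<le> n \<Longrightarrow> enat k \<le> m \<Longrightarrow> (\<Sum>i=1..k. a i) \<le> (\<Sum>j<k. C - \<nu> j)"
      using nec by (auto intro: has_sum_imp_summable)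
  next
    assume sum: "a summable_on seq_idx m" and top: "\<nu> (n - 1) \<le> C"
      and maj: "\<forall>k. 1 \<le> k \<and> k \<le> n \<and> enat k \<le> m \<longrightarrow> (\<Sum>i=1..k. a i) \<le> (\<Sum>j<k. C - \<nu> j)"
    have nonneg: "C - \<nu> j \<ge> 0" if "j < n" for j
      using monotone_onD[OF mono, of j "n - 1"] that top by fastforce
    have total: "(a has_sum (\<Sum>j<n. C - \<nu> j)) (seq_idx m)"
      using has_sum_infsum[OF sum] nC by (simp add: sum_subtractf \<alpha>)
    \<comment> \<open>A tight frame needs a positive constant: \<open>n C\<close> is at least \<open>a 1\<close>, as \<open>m \<ge> 1\<close>.\<close>
    have "a 1 \<le> (\<Sum>j<n. C - \<nu> j)"
      using finite_sum_le_has_sum[OF total, of "{1}"] a(2) m by (force simp: seq_idx_def one_enat_def less_imp_le)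
    moreover have "a 1 > 0" using a(2) by simp
    ultimately have "0 < real n * C" using \<nu>_nonneg sum_nonneg[of "{..<n}" \<nu>] by (simp add: sum_subtractf)
    then have "C > 0" using n by (simp add: zero_less_mult_iff)
    have anti: "antimono_on {..<n} (\<lambda>j. C - \<nu> j)" using mono by (auto simp: monotone_on_def)
    have maj': "(\<Sum>i=1..k. a i) \<le> (\<Sum>j<k. C - \<nu> j)" if "k \<le> n" "enat k \<le> m" for k
      using maj that by (cases "k = 0") auto
    obtain g where "\<And>i. i \<in> seq_idx m \<Longrightarrow> (ip_norm ip (g i))\<^sup>2 = a i"
      "\<And>x. ((\<lambda>i. (norm (ip x (g i)))\<^sup>2) has_sum (\<Sum>j<n. (C - \<nu> j) * (norm (ip x (e j)))\<^sup>2)) (seq_idx m)"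
      using tight_completion_sufficient[OF on n anti nonneg a(1) less_imp_le[OF a(2)[rule_format]] total maj'] by blast
    then show ?L using tight_frame_concat_iff[OF on span Te] \<open>C > 0\<close> by blast
  qed
  finally show ?thesis by simp
qed

lemma tight_frame_concat_bessel:
  assumes "tight_frame ip (enat p + m) (seq_concat p f g)"
  shows "bessel_seq ip m g"
proof -
  obtain c where "c > 0"
    and c: "\<And>x. ((\<lambda>i. (norm (ip x (g i)))\<^sup>2) has_sum (c * (ip_norm ip x)\<^sup>2 - (\<Sum>i=1..p. (norm (ip x (f i)))\<^sup>2))) (seq_idx m)"
    using assms has_sum_seq_concat[where F = "\<lambda>y. (norm (ip _ y))\<^sup>2"] unfolding tight_frame_def by blast
  have "(\<Sum>\<^sub>\<infinity>i\<in>seq_idx m. (norm (ip x (g i)))\<^sup>2) \<le> c * (ip_norm ip x)\<^sup>2" for x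
    using infsumI[OF c[of x]] by (simp add: sum_nonneg)
  then show ?thesis
    unfolding bessel_seq_def using \<open>c > 0\<close> c has_sum_imp_summable by blast
qed

end

theorem theoremA:
  fixes smul :: "'k::real_or_complex \<Rightarrow> 'v::ab_group_add \<Rightarrow> 'v"
    and ip :: "'v \<Rightarrow> 'v \<Rightarrow> 'k"
    and n p :: nat
    and f :: "nat \<Rightarrow> 'v"
    and l a :: "nat \<Rightarrow> real"
    and \<alpha> :: real
  assumes "inner_product_space smul ip"
    and "n \<ge> 1"
    and "vector_space.dim smul (UNIV :: 'v set) = n"
    and "p \<ge> 1"
    and "ordered_eigenvalues smul (frame_operator smul ip p f) n l"
    and "of_real \<alpha> = operator_trace smul (frame_operator smul ip p f)"
    and "antimono_on {1..} a"
    and "\<forall>i\<ge>1. a i > 0"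
  shows "(\<forall>r\<ge>1.
            (\<exists>g. (\<forall>i\<in>{1..r}. (ip_norm ip (g i))\<^sup>2 = a i) \<and>
                 tight_frame ip (enat (p + r)) (seq_concat p f g)) \<longleftrightarrow>
            (1 / real n * ((\<Sum>i=1..r. a i) + \<alpha>) \<ge> l 1 \<and>
             (\<forall>k. 1 \<le> k \<and> k \<le> min n r \<longrightarrow>
                1 / real n * ((\<Sum>i=1..r. a i) + \<alpha>)
                  \<ge> 1 / real k * (\<Sum>i=1..k. a i + l (n - i + 1))))) \<and>
         ((\<exists>g. bessel_seq ip \<infinity> g \<and>
               (\<forall>i\<ge>1. (ip_norm ip (g i))\<^sup>2 = a i) \<and>
               tight_frame ip \<infinity> (seq_concat p f g)) \<longleftrightarrow>
          (a abs_summable_on {1..} \<and>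
           1 / real n * ((\<Sum>\<^sub>\<infinity>i\<in>{1..}. a i) + \<alpha>) \<ge> l 1 \<and>
           (\<forall>k. 1 \<le> k \<and> k \<le> n \<longrightarrow>
              1 / real n * ((\<Sum>\<^sub>\<infinity>i\<in>{1..}. a i) + \<alpha>)
                \<ge> 1 / real k * (\<Sum>i=1..k. a i + l (n - i + 1)))))"
proof -
  interpret inner_product_space smul ip by (rule assms)
  have a_pos: "\<And>i. i \<ge> 1 \<Longrightarrow> a i > 0" using assms by blast
  note iff = tight_completion_iff[OF assms(2,3,5,6,7,8)]
  have abs_summable: "a abs_summable_on {1..} \<longleftrightarrow> a summable_on {1..}"
    using a_pos by (intro summable_on_cong) (simp add: less_imp_le)
  show ?thesis
  proof (intro conjI allI impI, goal_cases)
    case (1 r)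
    then have "1 \<le> enat r" by (simp add: one_enat_def)
    from iff[OF this] show ?case by (simp add: seq_idx_enat)
  next
    case 2
    have "(\<exists>g. bessel_seq ip \<infinity> g \<and> (\<forall>i\<ge>1. (ip_norm ip (g i))\<^sup>2 = a i) \<and> tight_frame ip \<infinity> (seq_concat p f g)) \<longleftrightarrow>
      (\<exists>g. (\<forall>i\<in>seq_idx \<infinity>. (ip_norm ip (g i))\<^sup>2 = a i) \<and> tight_frame ip (enat p + \<infinity>) (seq_concat p f g))"
      using tight_frame_concat_bessel[of p \<infinity> f] by (auto simp: seq_idx_infinity)
    also note iff[of \<infinity>]
    finally show ?case unfolding abs_summable seq_idx_infinity by simp
  qed
qed

end
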